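(* Let $h\in\mathbb R\setminus\{0\}$. The function $x\mapsto \exp_h(x,y)$ is the eigenfunction of the operator $\dfrac{d}{d^h x}$ with eigenvalue $y$, i.e. $$\frac{d}{d^h x}\,\exp_h(x,y)=y\,\exp_h(x,y).$$
   Context: For $h\in\mathbb R\setminus\{0\}$, the deformed exponential function $\exp_h$ of two variables is $$\exp_h(x,y)=\bigl(hx+\sqrt{1+h^2x^2}\bigr)^{y/h}\qquad (x\in\mathbb C,\ y\in\mathbb R).$$ Set $$z\ominus^h u=z\sqrt{1+h^2u^2}-u\sqrt{1+h^2z^2}.$$ The deformed $h$-derivative is $$\frac{df(z)}{d^hz}=\lim_{u\to z}\frac{f(z)-f(u)}{z\ominus^h u}=\sqrt{1+h^2z^2}\,\frac{df(z)}{dz}.$$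
   Formalization: With principal square root and power, the identity is stated for all complex x except x = it with t real and |ht| > 1; on these open branch cuts the square root jumps and the identity fails (e.g. y = h). All real x and the branch points x = ±i/h are included. *)

theory Defs
  imports "HOL-Complex_Analysis.Complex_Analysis"
begin

text \<open>
  Square root and power are the principal ones (\<^const>\<open>csqrt\<close>, complex \<^const>\<open>powr\<close>).
\<close>

definition exp_h :: "real \<Rightarrow> complex \<Rightarrow> real \<Rightarrow> complex" where
  "exp_h h x y =
     (of_real h * x + csqrt (1 + (of_real h)\<^sup>2 * x\<^sup>2)) powr (of_real (y / h))"

definition ominus_h :: "real \<Rightarrow> complex \<Rightarrow> complex \<Rightarrow> complex" where
  "ominus_h h z u =
     z * csqrt (1 + (of_real h)\<^sup>2 * u\<^sup>2) - u * csqrt (1 + (of_real h)\<^sup>2 * z\<^sup>2)"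

text \<open>
  A relation rather than a total operator, so that existence of the limit is part of the claim.
\<close>

definition has_h_derivative ::
    "real \<Rightarrow> (complex \<Rightarrow> complex) \<Rightarrow> complex \<Rightarrow> complex \<Rightarrow> bool" where
  "has_h_derivative h f D z \<longleftrightarrow>
     ((\<lambda>u. (f z - f u) / ominus_h h z u) \<longlongrightarrow> D) (at z)"

text \<open>
  The plane minus the two open rays \<open>x = i t\<close>, \<open>\<bar>h\<bar> \<bar>t\<bar> > 1\<close>, across which the principal value
  of \<open>sqrt (1 + h\<^sup>2 x\<^sup>2)\<close> jumps.  The whole real line and the two branch points
  \<open>x = i/h\<close>, \<open>x = -i/h\<close> belong to this set.
\<close>

definition h_domain :: "real \<Rightarrow> complex set" where
  "h_domain h = {x. 1 + (of_real h)\<^sup>2 * x\<^sup>2 \<notin> of_real ` {..<0::real}}"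

definition h_eigenfunction ::
    "real \<Rightarrow> complex set \<Rightarrow> (complex \<Rightarrow> complex) \<Rightarrow> complex \<Rightarrow> bool" where
  "h_eigenfunction h S f c \<longleftrightarrow>
     (\<exists>x\<in>S. f x \<noteq> 0) \<and> (\<forall>x\<in>S. has_h_derivative h f (c * f x) x)"

text \<open>
  The formula \<open>sqrt (1 + h\<^sup>2 z\<^sup>2) * df/dz\<close> for the deformed derivative, valid wherever \<open>f\<close> and the
  principal square root are complex differentiable.
\<close>

lemma has_h_derivative_of_field_derivative:
  assumes f: "(f has_field_derivative f') (at z)"
    and z: "1 + (of_real h)\<^sup>2 * z\<^sup>2 \<notin> \<real>\<^sub>\<le>\<^sub>0"
  shows "has_h_derivative h f (csqrt (1 + (of_real h)\<^sup>2 * z\<^sup>2) * f') z"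
proof -
  define s where "s = csqrt (1 + (of_real h)\<^sup>2 * z\<^sup>2)"
  have s2: "s\<^sup>2 = 1 + (of_real h)\<^sup>2 * z\<^sup>2"
    by (simp add: s_def)
  have s0: "s \<noteq> 0"
    using z by (auto simp: s_def)
  have "((\<lambda>u. ominus_h h z u) has_field_derivative
          z * (2 * (of_real h)\<^sup>2 * z / (2 * s)) - s) (at z)"
    unfolding ominus_h_def s_def using z
    by (auto intro!: derivative_eq_intros)
  moreover have "z * (2 * (of_real h)\<^sup>2 * z / (2 * s)) - s = - 1 / s"
    using s0 s2 by (simp add: field_simps power2_eq_square)
  ultimately have g: "((\<lambda>u. ominus_h h z u) has_field_derivative (- 1 / s)) (at z)"
    by simp
  have "((\<lambda>u. - (((f u - f z) / (u - z)) /
            ((ominus_h h z u - ominus_h h z z) / (u - z)))) \<longlongrightarrow> - (f' / (- 1 / s))) (at z)"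
    by (rule tendsto_minus[OF tendsto_divide[OF f[unfolded has_field_derivative_iff]
          g[unfolded has_field_derivative_iff]]]) (use s0 in simp)
  then have lim: "((\<lambda>u. - (((f u - f z) / (u - z)) /
            ((ominus_h h z u - ominus_h h z z) / (u - z)))) \<longlongrightarrow> s * f') (at z)"
    by (simp add: mult.commute)
  have "- (((f u - f z) / (u - z)) / ((ominus_h h z u - ominus_h h z z) / (u - z)))
          = (f z - f u) / ominus_h h z u" if "u \<noteq> z" for u
  proof -
    have "ominus_h h z z = 0"
      by (simp add: ominus_h_def)
    with that show ?thesis
      by (simp add: minus_divide_left)
  qed
  then have "\<forall>\<^sub>F u in at z. - (((f u - f z) / (u - z)) /
            ((ominus_h h z u - ominus_h h z z) / (u - z))) = (f z - f u) / ominus_h h z u"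
    by (simp add: eventually_at_filter)
  with lim show ?thesis
    unfolding has_h_derivative_def s_def[symmetric]
    by (rule Lim_transform_eventually)
qed

end

theory Submission imports Defs begin

text \<open>
  Write \<open>w x = h x + sqrt (1 + h\<^sup>2 x\<^sup>2)\<close>, so that \<open>exp_h h x y = (w x) powr (y / h)\<close>.  This \<open>w\<close>
  uniformizes the curve \<open>s\<^sup>2 = 1 + h\<^sup>2 x\<^sup>2\<close>: both \<open>h x = (w - 1/w) / 2\<close> and \<open>s = (w + 1/w) / 2\<close>
  are rational in \<open>w\<close>, because \<open>(s + h x) (s - h x) = 1\<close>.  In this coordinate the deformed
  difference factors,
  \<open>z \<ominus>\<^sup>h u = (w z - w u) (w z + w u) / (2 h (w z) (w u))\<close>,
  so with \<open>c = y / h\<close> the deformed difference quotient of \<open>exp_h\<close> is an ordinary difference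
  quotient of \<open>v \<mapsto> v powr c\<close> between \<open>w u\<close> and \<open>w z\<close>, times \<open>2 h (w z) (w u) / (w z + w u)\<close>.
  If \<open>w u \<rightarrow> w z\<close>, the limit is \<open>c (w z)\<^bsup>c - 1\<^esup> \<cdot> h (w z) = y (w z)\<^bsup>c\<^esup>\<close>.

  Continuity of \<open>w\<close> at \<open>z\<close> is enough for this, and it persists at the branch points \<open>\<plusminus>i/h\<close>,
  where \<open>w\<close> has no derivative and the formula \<open>sqrt (1 + h\<^sup>2 z\<^sup>2) df/dz\<close> gives no value.  The other
  ingredient is that \<open>w\<close> avoids the cut of the principal power, since the principal square root
  has nonnegative real part.
\<close>

definition exp_h_base :: "real \<Rightarrow> complex \<Rightarrow> complex" where
  "exp_h_base h x = of_real h * x + csqrt (1 + (of_real h)\<^sup>2 * x\<^sup>2)"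

lemma exp_h_eq_powr: "exp_h h x y = exp_h_base h x powr of_real (y / h)"
  by (simp add: exp_h_def exp_h_base_def)

lemma exp_h_base_conjugate:
  "exp_h_base h x * (csqrt (1 + (of_real h)\<^sup>2 * x\<^sup>2) - of_real h * x) = 1"
proof -
  have "(csqrt (1 + (of_real h)\<^sup>2 * x\<^sup>2))\<^sup>2 = 1 + (of_real h)\<^sup>2 * x\<^sup>2"
    by simp
  then show ?thesis
    unfolding exp_h_base_def by algebra
qed

lemma exp_h_base_nonzero: "exp_h_base h x \<noteq> 0"
  using exp_h_base_conjugate[of h x] by auto

lemma inverse_exp_h_base:
  "inverse (exp_h_base h x) = csqrt (1 + (of_real h)\<^sup>2 * x\<^sup>2) - of_real h * x"
  by (rule inverse_unique[OF exp_h_base_conjugate])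

lemma h_times_eq_exp_h_base:
  "of_real h * x = (exp_h_base h x - inverse (exp_h_base h x)) / 2"
  unfolding inverse_exp_h_base by (simp add: exp_h_base_def)

lemma csqrt_eq_exp_h_base:
  "csqrt (1 + (of_real h)\<^sup>2 * x\<^sup>2) = (exp_h_base h x + inverse (exp_h_base h x)) / 2"
  unfolding inverse_exp_h_base by (simp add: exp_h_base_def)

lemma exp_h_base_eq_iff:
  assumes "h \<noteq> 0"
  shows "exp_h_base h x = exp_h_base h z \<longleftrightarrow> x = z"
proof
  assume "exp_h_base h x = exp_h_base h z"
  then have "of_real h * x = of_real h * z"
    by (simp only: h_times_eq_exp_h_base)
  with assms show "x = z"
    by simp
qed simp

text \<open>
  A base on the negative real axis would make \<open>(w + 1/w) / 2\<close> negative, but this is a value of the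
  principal square root.
\<close>

lemma exp_h_base_not_nonpos_Reals: "exp_h_base h x \<notin> \<real>\<^sub>\<le>\<^sub>0"
proof
  assume "exp_h_base h x \<in> \<real>\<^sub>\<le>\<^sub>0"
  then obtain r where r: "exp_h_base h x = of_real r" "r \<le> 0"
    by (auto elim: nonpos_Reals_cases)
  with exp_h_base_nonzero[of h x] have "r < 0"
    by (cases "r = 0") auto
  moreover have "csqrt (1 + (of_real h)\<^sup>2 * x\<^sup>2) = of_real ((r + inverse r) / 2)"
    by (simp add: csqrt_eq_exp_h_base r)
  then have "0 \<le> (r + inverse r) / 2"
    using Re_csqrt[of "1 + (of_real h)\<^sup>2 * x\<^sup>2"] by (metis Re_complex_of_real)
  ultimately show False
    using add_neg_neg[of r "inverse r"] by simp
qed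

text \<open>
  On the cut only the argument of the principal square root jumps; at its endpoint \<open>0\<close> the modulus
  \<open>sqrt \<bar>a\<bar>\<close> tends to \<open>0\<close>, which restores continuity.
\<close>

lemma isCont_csqrt_of_not_negative:
  assumes "a \<notin> of_real ` {..<0::real}"
  shows "isCont csqrt a"
proof (cases "a = 0")
  case True
  have "((\<lambda>u::complex. sqrt (norm u)) \<longlongrightarrow> sqrt (norm (0::complex))) (at 0)"
    by (intro tendsto_intros)
  then have "((\<lambda>u. norm (csqrt u)) \<longlongrightarrow> 0) (at 0)"
    by (simp add: norm_csqrt)
  then have "(csqrt \<longlongrightarrow> 0) (at 0)"
    by (rule tendsto_norm_zero_cancel)
  then show ?thesis
    using True by (simp add: isCont_def)
next
  case False
  have "a \<notin> \<real>\<^sub>\<le>\<^sub>0"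
  proof
    assume "a \<in> \<real>\<^sub>\<le>\<^sub>0"
    then obtain r where "a = of_real r" "r \<le> 0"
      by (auto elim: nonpos_Reals_cases)
    with False assms show False
      by (cases "r = 0") auto
  qed
  then show ?thesis
    by (rule continuous_at_csqrt)
qed

lemma isCont_exp_h_base:
  assumes "x \<in> h_domain h"
  shows "isCont (exp_h_base h) x"
proof -
  have "isCont csqrt (1 + (of_real h)\<^sup>2 * x\<^sup>2)"
    using assms by (intro isCont_csqrt_of_not_negative) (simp add: h_domain_def)
  then have "isCont (\<lambda>u. csqrt (1 + (of_real h)\<^sup>2 * u\<^sup>2)) x"
    by (rule isCont_o2[rotated]) (intro continuous_intros)
  then show ?thesis
    unfolding exp_h_base_def by (intro continuous_intros)
qed

lemma ominus_h_eq_exp_h_base: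
  assumes "h \<noteq> 0"
  shows "ominus_h h z u =
    (exp_h_base h z - exp_h_base h u) * (exp_h_base h z + exp_h_base h u) /
      (2 * of_real h * exp_h_base h z * exp_h_base h u)"
proof -
  define w v where "w = exp_h_base h z" and "v = exp_h_base h u"
  have nz: "w \<noteq> 0" "v \<noteq> 0"
    by (simp_all add: w_def v_def exp_h_base_nonzero)
  have "of_real h * ominus_h h z u =
      (of_real h * z) * csqrt (1 + (of_real h)\<^sup>2 * u\<^sup>2) -
      (of_real h * u) * csqrt (1 + (of_real h)\<^sup>2 * z\<^sup>2)"
    by (simp add: ominus_h_def algebra_simps)
  also have "\<dots> = (w - inverse w) / 2 * ((v + inverse v) / 2) -
      (v - inverse v) / 2 * ((w + inverse w) / 2)"
    unfolding h_times_eq_exp_h_base csqrt_eq_exp_h_base w_def v_def ..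
  also have "\<dots> = (w - v) * (w + v) / (2 * w * v)"
    using nz by (simp add: field_simps)
  finally show ?thesis
    using assms nz unfolding w_def[symmetric] v_def[symmetric]
    by (simp add: field_simps)
qed

lemma has_h_derivative_exp_h:
  assumes h: "h \<noteq> 0" and z: "z \<in> h_domain h"
  shows "has_h_derivative h (\<lambda>x. exp_h h x y) (of_real y * exp_h h z y) z"
proof -
  define w where "w = exp_h_base h"
  define c :: complex where "c = of_real (y / h)"
  have exp_h_w: "exp_h h x y = w x powr c" for x
    by (simp only: exp_h_eq_powr w_def c_def)
  have w0: "w z \<noteq> 0"
    by (simp add: w_def exp_h_base_nonzero)
  have lim: "(w \<longlongrightarrow> w z) (at z)"
    using isCont_exp_h_base[OF z] by (simp add: isCont_def w_def)
  have "((\<lambda>v. v powr c) has_field_derivative c * w z powr (c - 1)) (at (w z))"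
    using exp_h_base_not_nonpos_Reals[of h z]
    by (intro has_field_derivative_powr) (simp add: w_def)
  then have "((\<lambda>v. (v powr c - w z powr c) / (v - w z)) \<longlongrightarrow> c * w z powr (c - 1)) (at (w z))"
    by (simp add: has_field_derivative_iff)
  \<comment> \<open>Injectivity of \<open>w\<close> keeps \<open>w u\<close> away from \<open>w z\<close>, as the punctured limit requires.\<close>
  moreover have "filterlim w (at (w z)) (at z)"
    using lim exp_h_base_eq_iff[OF h]
    by (auto simp: filterlim_at w_def eventually_at_filter)
  ultimately have "((\<lambda>u. (w u powr c - w z powr c) / (w u - w z)) \<longlongrightarrow> c * w z powr (c - 1)) (at z)"
    by (rule filterlim_compose)
  moreover have "((\<lambda>u. 2 * of_real h * w z * w u / (w z + w u)) \<longlongrightarrow>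
      2 * of_real h * w z * w z / (w z + w z)) (at z)"
    using w0 by (intro tendsto_intros lim) simp
  ultimately have "((\<lambda>u. (w u powr c - w z powr c) / (w u - w z) *
      (2 * of_real h * w z * w u / (w z + w u))) \<longlongrightarrow>
      c * w z powr (c - 1) * (2 * of_real h * w z * w z / (w z + w z))) (at z)"
    by (rule tendsto_mult)
  moreover have "(w u powr c - w z powr c) / (w u - w z) *
      (2 * of_real h * w z * w u / (w z + w u)) =
      (exp_h h z y - exp_h h u y) / ominus_h h z u" for u
  proof -
    have "(w u powr c - w z powr c) / (w u - w z) = (w z powr c - w u powr c) / (w z - w u)"
      using minus_divide_divide[of "w z powr c - w u powr c" "w z - w u"] by simp
    then show ?thesis
      by (simp add: exp_h_w ominus_h_eq_exp_h_base[OF h] flip: w_def)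
  qed
  moreover have "c * w z powr (c - 1) * (2 * of_real h * w z * w z / (w z + w z)) =
      of_real y * exp_h h z y"
  proof -
    have "2 * of_real h * w z * w z / (w z + w z) = of_real h * w z"
      using w0 by (simp add: field_simps)
    moreover have "w z powr (c - 1) * w z = w z powr c"
      using w0 by (simp add: powr_diff)
    moreover have "c * of_real h = of_real y"
      using h by (simp add: c_def)
    ultimately show ?thesis
      unfolding exp_h_w by (metis mult.assoc mult.commute)
  qed
  ultimately show ?thesis
    by (simp add: has_h_derivative_def)
qed

theorem theorem5p2:
  fixes h y :: real
  assumes "h \<noteq> 0"
  shows "h_eigenfunction h (h_domain h) (\<lambda>x. exp_h h x y) (of_real y)"
proof -
  have "0 \<in> h_domain h"
    by (auto simp: h_domain_def complex_eq_iff)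
  moreover have "exp_h h 0 y \<noteq> 0"
    by (simp add: exp_h_def)
  ultimately show ?thesis
    unfolding h_eigenfunction_def using has_h_derivative_exp_h[OF assms] by blast
qed

end
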